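(* Let $p>0$ be real and $\mathfrak{S}=\{x\in\mathbb{C}: -1\le \operatorname{Im}(x)\le 0\}$. Let $F_o$ be an odd complex function, analytic on an open set (symmetric about $0$) containing $\{x\in\mathbb{C}:|\operatorname{Im}(x)|\le1\}$, such that, uniformly for $x\in\mathfrak{S}$ as $\operatorname{Re}(x)\to\pm\infty$, $F_o(x)-F_o(x+i)=o\!\left(e^{\pi|x|}/|x|\right)$ and $\dfrac{F_o(x)-F_o(x+i)}{\sinh(\pi p(2x+i))}\to0$. Assume that the integrand below has no pole on the real axis (automatic if $p$ is not an integer). Then $$\int_{-\infty}^{\infty}\frac{F_o(x)-F_o(i+x)}{\sinh(\pi p(2x+i))}\,dx=\frac{i}{2p}\sum_{n=\lfloor -p\rfloor}^{-1+\lfloor p\rfloor}(-1)^n\left(F_o\!\left(\frac{i(n+1-p)}{2p}\right)-F_o\!\left(\frac{i(n+1+p)}{2p}\right)\right).$$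
   Context: The integral over the real line is understood as $\lim_{R\to\infty}\int_{-R}^{R}$ (removable singularities of the integrand being filled in); $\lfloor y\rfloor$ is the greatest integer not exceeding $y$. *)

theory Defs
  imports "HOL-Complex_Analysis.Complex_Analysis" "HOL-Library.Landau_Symbols"
begin

definition strip :: "complex set" where
  "strip = {x. -1 \<le> Im x \<and> Im x \<le> 0}"

(* Eventual statements along this filter are uniform in Im x. *)
definition strip_ends :: "complex filter" where
  "strip_ends = inf (filtercomap (\<lambda>x. \<bar>Re x\<bar>) at_top) (principal strip)"

definition integrand :: "(complex \<Rightarrow> complex) \<Rightarrow> real \<Rightarrow> complex \<Rightarrow> complex" where
  "integrand F p x = (F x - F (\<i> + x)) / sinh (of_real (pi * p) * (2 * x + \<i>))"

(* The symmetric limit of Henstock-Kurzweil integrals. Integrability is demanded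
   explicitly because integral returns 0 on functions that are not integrable. *)
definition has_symmetric_integral :: "(real \<Rightarrow> complex) \<Rightarrow> complex \<Rightarrow> bool" where
  "has_symmetric_integral f I \<longleftrightarrow>
     (\<forall>R. f integrable_on {-R..R}) \<and>
     ((\<lambda>R. integral {-R..R} f) \<longlongrightarrow> I) at_top"

end

theory Submission
  imports Defs
begin

text \<open>
  Write \<open>G x = F x - F (x + \<i>)\<close> and \<open>f x = G x / sinh (\<pi> p (2 x + \<i>))\<close>. Since \<open>F\<close> is odd,
  \<open>G\<close> is invariant under the point reflection \<open>x \<mapsto> - \<i> - x\<close> in the centre \<open>- \<i> / 2\<close> of the
  strip, whereas the hyperbolic sine changes sign. So \<open>f\<close> is odd about \<open>- \<i> / 2\<close>, and the
  integral of \<open>f\<close> over the lower edge \<open>[-R, R] - \<i>\<close>, taken from left to right, is minus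
  the integral over \<open>[-R, R]\<close>. The boundary of the rectangle with these two horizontal edges
  therefore contributes \<open>-2\<close> times the wanted integral plus two vertical sides of length 1,
  and these vanish as \<open>R \<rightarrow> \<infinity>\<close> because \<open>f\<close> tends to 0 uniformly in the strip. By the residue
  theorem the integral equals \<open>- \<pi> \<i>\<close> times the sum of the residues of \<open>f\<close> inside the strip;
  this is \<open>has_symmetric_integral_odd_about_strip_centre\<close>.

  The denominator has simple zeros exactly at the points \<open>x k = \<i> (k - p) / (2 p)\<close> for integer
  \<open>k\<close>, with derivative \<open>2 \<pi> p (-1)^k\<close> there. The residue of \<open>f\<close> at \<open>x k\<close> is thus
  \<open>(-1)^k G (x k) / (2 \<pi> p)\<close>, the points inside the strip are those with \<open>\<bar>k\<bar> < p\<close>, and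
  \<open>n = k - 1\<close> gives the sum in the theorem.

  If \<open>p\<close> is an integer, the zeros \<open>x p = 0\<close> and \<open>x (-p) = - \<i>\<close> lie on the contour. As \<open>f\<close> has
  no pole at 0, the numerator vanishes there, \<open>G 0 = 0\<close>, and by reflection \<open>G (- \<i>) = 0\<close>. Both
  singularities are then removable, so that the contour argument applies to \<open>remove_sings f\<close>,
  and the term \<open>k = p\<close>, which is present in the sum but comes from no pole, is zero.
\<close>

section \<open>Contour integrals over rectangles\<close>

lemma eventually_strip_ends:
  "eventually P strip_ends \<longleftrightarrow> (\<exists>M. \<forall>x\<in>strip. M \<le> \<bar>Re x\<bar> \<longrightarrow> P x)"
  unfolding strip_ends_def eventually_inf_principal eventually_filtercomap_at_top_linorder
  by blast

lemma contour_integral_horizontal: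
  assumes "a < b"
  shows "contour_integral (linepath (Complex a c) (Complex b c)) f
           = integral {a..b} (\<lambda>t. f (of_real t + of_real c * \<i>))"
proof -
  have "contour_integral (linepath (Complex a c) (Complex b c)) f
          = contour_integral (linepath (of_real a) (of_real b)) (\<lambda>z. f (z + of_real c * \<i>))"
    by (simp add: contour_integral_integral vector_derivative_linepath_within linepath_def
        Complex_eq algebra_simps scaleR_conv_of_real)
  also have "\<dots> = integral {a..b} (\<lambda>t. f (of_real t + of_real c * \<i>))"
    using assms by (subst contour_integral_linepath_Reals_eq) auto
  finally show ?thesis .
qed

text \<open>
  The residue theorem asks for a connected domain. An open set \<open>W\<close> containing the rectangle
  need not be connected, but by compactness it contains a uniform neighbourhood of the
  rectangle, and this neighbourhood is a sum of two convex sets.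
\<close>
lemma contour_integral_rectpath_residues:
  assumes "Re a \<le> Re b" "Im a \<le> Im b" and W: "open W" "cbox a b \<subseteq> W"
    and P: "finite P" "P \<subseteq> box a b" and g: "g holomorphic_on W - P"
  shows "contour_integral (rectpath a b) g = 2 * pi * \<i> * (\<Sum>z\<in>P. residue g z)"
proof -
  obtain e where e: "e > 0" "(\<Union>x\<in>cbox a b. ball x e) \<subseteq> W"
    using compact_subset_open_imp_ball_epsilon_subset[OF compact_cbox W] by blast
  define S where "S = (\<Union>x\<in>cbox a b. ball x e)"
  have "S = (\<Union>x\<in>cbox a b. \<Union>y\<in>ball 0 e. {x + y})"
  proof -
    have "(\<Union>y\<in>ball 0 e. {x + y}) = ball x e" for x :: complex
      by (simp add: UNION_singleton_eq_range)
    then show ?thesis unfolding S_def by (simp only:)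
  qed
  then have "convex S"
    using convex_sums[OF convex_box(1) convex_ball] by metis
  have cb: "cbox a b \<subseteq> S"
    using e(1) unfolding S_def by force
  have im: "path_image (rectpath a b) = cbox a b - box a b"
    using assms(1,2) by (rule path_image_rectpath_cbox_minus_box)
  have "contour_integral (rectpath a b) g
          = 2 * pi * \<i> * (\<Sum>z\<in>P. winding_number (rectpath a b) z * residue g z)"
  proof (rule Residue_theorem)
    show "open S" by (auto simp: S_def)
    show "connected S" using \<open>convex S\<close> by (rule convex_connected)
    show "g holomorphic_on S - P"
      by (rule holomorphic_on_subset[OF g]) (use e(2) S_def in auto)
    show "path_image (rectpath a b) \<subseteq> S - P"
      using cb P(2) im by auto
    show "\<forall>z. z \<notin> S \<longrightarrow> winding_number (rectpath a b) z = 0"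
      using winding_number_rectpath_outside[OF assms(1,2)] cb by blast
  qed (use P in auto)
  also have "(\<Sum>z\<in>P. winding_number (rectpath a b) z * residue g z) = (\<Sum>z\<in>P. residue g z)"
    by (intro sum.cong) (use P(2) winding_number_rectpath in auto)
  finally show ?thesis .
qed

text \<open>
  Oddness about the centre \<open>- \<i> / 2\<close> makes the two horizontal edges of the contour contribute
  equally, so one contour integral yields the integral along the real line itself, with half
  of the usual factor \<open>2 \<pi> \<i>\<close>. The sign is negative because the real line is the upper
  edge, which the positively oriented rectangle traverses from right to left. The point
  \<open>t = 0\<close>, where the function may come from removing a singularity on the contour, can be left
  out of the symmetry because a null set does not affect the integrals.
\<close>
lemma has_symmetric_integral_odd_about_strip_centre:
  assumes W: "open W" "strip \<subseteq> W"
    and P: "finite P" "\<And>z. z \<in> P \<Longrightarrow> -1 < Im z \<and> Im z < 0"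
    and g: "g holomorphic_on W - P"
    and odd: "\<And>t::real. t \<noteq> 0 \<Longrightarrow> g (- \<i> - of_real t) = - g (of_real t)"
    and lim: "(g \<longlongrightarrow> 0) strip_ends"
  shows "has_symmetric_integral (\<lambda>t. g (of_real t)) (- (pi * \<i> * (\<Sum>z\<in>P. residue g z)))"
proof -
  define S where "S = (\<Sum>z\<in>P. residue g z)"
  define I where "I R = integral {-R..R} (\<lambda>t. g (of_real t))" for R :: real
  have cont: "continuous_on (W - P) g"
    using g by (rule holomorphic_on_imp_continuous_on)
  have real: "of_real t \<in> W - P" for t :: real
    using W(2) P(2)[of "of_real t"] by (auto simp: strip_def)
  have "(\<lambda>t. g (of_real t)) integrable_on {-R..R}" for R :: real
    by (intro integrable_continuous_interval continuous_on_compose2[OF cont] continuous_intros)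
       (use real in auto)
  moreover have "(I \<longlongrightarrow> - (pi * \<i> * S)) at_top"
  proof (rule tendstoI)
    fix e :: real
    assume "e > 0"
    then have "eventually (\<lambda>x. dist (g x) 0 < e / 2) strip_ends"
      by (intro tendstoD[OF lim]) simp
    then obtain M where M: "\<And>x. x \<in> strip \<Longrightarrow> M \<le> \<bar>Re x\<bar> \<Longrightarrow> norm (g x) < e / 2"
      by (auto simp: eventually_strip_ends)
    have close: "dist (I R) (- (pi * \<i> * S)) < e"
      if R: "R > 0" "R \<ge> M" "\<And>z. z \<in> P \<Longrightarrow> \<bar>Re z\<bar> < R" for R :: real
    proof -
      define a b c d where "a = Complex (-R) (-1)" and "b = Complex R (-1)"
        and "c = Complex R 0" and "d = Complex (-R) 0"
      note corners = a_def b_def c_def d_def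
      have box: "box a c = {z. -R < Re z \<and> Re z < R \<and> -1 < Im z \<and> Im z < 0}"
        and cbox: "cbox a c = {z. -R \<le> Re z \<and> Re z \<le> R \<and> -1 \<le> Im z \<and> Im z \<le> 0}"
        by (auto simp: corners in_box_complex_iff in_cbox_complex_iff)
      have PB: "P \<subseteq> box a c"
        using R(3) P(2) by (force simp: box abs_less_iff)
      have "contour_integral (rectpath a c) g = 2 * pi * \<i> * S"
        unfolding S_def
        by (rule contour_integral_rectpath_residues[OF _ _ W(1) _ P(1) PB g])
           (use W(2) R in \<open>auto simp: corners cbox[unfolded corners] strip_def\<close>)
      moreover have boundary: "cbox a c - box a c \<subseteq> W - P"
        using PB W(2) by (auto simp: cbox strip_def)
      have segments: "closed_segment a b \<subseteq> cbox a c - box a c"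
          "closed_segment b c \<subseteq> cbox a c - box a c"
          "closed_segment c d \<subseteq> cbox a c - box a c"
          "closed_segment d a \<subseteq> cbox a c - box a c"
        unfolding box cbox using R(1)
        by (auto simp: corners closed_segment_same_Re closed_segment_same_Im
              closed_segment_eq_real_ivl)
      have "g contour_integrable_on linepath a b" "g contour_integrable_on linepath b c"
          "g contour_integrable_on linepath c d" "g contour_integrable_on linepath d a"
        using segments boundary
        by (blast intro: contour_integrable_continuous_linepath continuous_on_subset[OF cont])+
      note integrable = this
      have "contour_integral (rectpath a c) g = contour_integral (linepath a b) g
          + (contour_integral (linepath b c) g
          + (contour_integral (linepath c d) g + contour_integral (linepath d a) g))"
        using integrable by (simp add: rectpath_def Let_def corners)
      moreover have "contour_integral (linepath a b) g = - I R"
      proof -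
        have "contour_integral (linepath a b) g = integral {-R..R} (\<lambda>t. g (of_real t - \<i>))"
          using R(1) by (simp add: corners contour_integral_horizontal)
        also have "\<dots> = integral {-R..R} (\<lambda>t. - g (of_real (-t)))"
          by (rule integral_spike[of "{0}"]) (use odd[of "- t" for t] in \<open>auto simp: algebra_simps\<close>)
        also have "\<dots> = - I R"
          unfolding I_def using Henstock_Kurzweil_Integration.integral_reflect_real[of R "-R" "\<lambda>t. g (of_real t)"] by simp
        finally show ?thesis .
      qed
      moreover have "contour_integral (linepath c d) g = - I R"
      proof -
        have "contour_integral (linepath c d) g = - contour_integral (linepath d c) g"
          using segments(3) boundary
          by (blast intro: contour_integral_reverse_linepath continuous_on_subset[OF cont])
        then show ?thesis
          using R(1) by (simp add: corners contour_integral_horizontal I_def)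
      qed
      moreover have small: "norm (g x) \<le> e / 2"
        if "x \<in> closed_segment b c \<union> closed_segment d a" for x
      proof -
        have "x \<in> strip" "\<bar>Re x\<bar> = R"
          using that R(1) by (auto simp: corners closed_segment_same_Re
              closed_segment_eq_real_ivl strip_def)
        then show ?thesis
          using M[of x] R(2) by simp
      qed
      have "norm (contour_integral (linepath b c) g) \<le> e / 2 * norm (c - b)"
        using \<open>e > 0\<close> small by (intro contour_integral_bound_linepath[OF integrable(2)]) auto
      moreover have "norm (contour_integral (linepath d a) g) \<le> e / 2 * norm (a - d)"
        using \<open>e > 0\<close> small by (intro contour_integral_bound_linepath[OF integrable(4)]) auto
      moreover have "norm (c - b) = 1" "norm (a - d) = 1"
        by (simp_all add: corners cmod_def)
      ultimately have "2 * (I R - (- (pi * \<i> * S)))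
          = contour_integral (linepath b c) g + contour_integral (linepath d a) g"
        and sides: "norm (contour_integral (linepath b c) g) \<le> e / 2"
          "norm (contour_integral (linepath d a) g) \<le> e / 2"
        by (simp_all add: algebra_simps)
      then have "norm (2 * (I R - (- (pi * \<i> * S)))) \<le> e / 2 + e / 2"
        using norm_triangle_mono[OF sides] by simp
      then have "2 * norm (I R - (- (pi * \<i> * S))) \<le> e"
        by (simp only: norm_mult) simp
      then show ?thesis
        using \<open>e > 0\<close> by (simp add: dist_norm)
    qed
    show "eventually (\<lambda>R. dist (I R) (- (pi * \<i> * S)) < e) at_top"
    proof -
      have "eventually (\<lambda>R. \<forall>z\<in>P. \<bar>Re z\<bar> < R) at_top"
        using P(1) by (simp add: eventually_ball_finite_distrib eventually_gt_at_top)
      then show ?thesis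
        using eventually_gt_at_top[of "0::real"] eventually_ge_at_top[of M]
        by eventually_elim (rule close, auto)
    qed
  qed
  ultimately show ?thesis
    by (simp add: has_symmetric_integral_def I_def[abs_def] S_def)
qed

section \<open>Quotients with a simple zero in the denominator\<close>

lemma is_pole_divide_DERIV_nonzero:
  fixes f s :: "complex \<Rightarrow> complex"
  assumes "isCont f z" "f z \<noteq> 0" "(s has_field_derivative d) (at z)" "s z = 0" "d \<noteq> 0"
  shows "is_pole (\<lambda>w. f w / s w) z"
proof (rule is_pole_divide)
  have "((\<lambda>w. s w / (w - z)) \<longlongrightarrow> d) (at z)"
    using assms(3,4) by (simp add: has_field_derivative_iff)
  then have "eventually (\<lambda>w. s w / (w - z) \<noteq> 0) (at z)"
    using assms(5) by (rule tendsto_imp_eventually_ne)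
  then have "eventually (\<lambda>w. s w \<noteq> 0) (at z)"
    by eventually_elim auto
  moreover have "(s \<longlongrightarrow> 0) (at z)"
    using DERIV_isCont[OF assms(3)] assms(4) by (simp add: isCont_def)
  ultimately show "filterlim s (at 0) (at z)"
    by (simp add: filterlim_at)
qed (use assms in auto)

text \<open>
  The numerator may vanish at \<open>z\<close>: the formula then says that the residue is 0, so that
  no distinction between poles and removable singularities is needed.
\<close>
lemma residue_divide_DERIV_nonzero:
  fixes f s :: "complex \<Rightarrow> complex"
  assumes "isCont f z" "(s has_field_derivative d) (at z)" "s z = 0" "d \<noteq> 0"
    and iso: "isolated_singularity_at (\<lambda>w. f w / s w) z"
  shows "residue (\<lambda>w. f w / s w) z = f z / d"
proof -
  obtain A where A: "open A" "z \<in> A" "(\<lambda>w. f w / s w) holomorphic_on A - {z}"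
    using iso analytic_imp_holomorphic by (auto simp: isolated_singularity_at_iff_analytic_nhd)
  have "((\<lambda>w. (w - z) / s w) \<longlongrightarrow> 1 / d) (at z)"
    by (rule lhopital_complex_simple[OF _ assms(2)]) (use assms in \<open>auto intro!: derivative_eq_intros\<close>)
  then have "((\<lambda>w. f w * ((w - z) / s w)) \<longlongrightarrow> f z * (1 / d)) (at z)"
    using assms(1) by (intro tendsto_mult) (simp_all add: isCont_def)
  then have "((\<lambda>w. f w / s w * (w - z)) \<longlongrightarrow> f z / d) (at z)"
    by simp
  with A show ?thesis
    by (rule residue_simple')
qed

section \<open>The zeros of the denominator\<close>

lemma sinh_eq_0_iff_complex: "sinh (z::complex) = 0 \<longleftrightarrow> (\<exists>k::int. z = of_int k * (pi * \<i>))"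
proof -
  have "sinh z = 0 \<longleftrightarrow> exp (2 * z) = 1"
    by (auto simp: sinh_zero_iff exp_double power2_eq_1_iff)
  then show ?thesis
    unfolding exp_eq_1 by (simp add: complex_eq_iff[of z])
qed

lemma cosh_int_pi_i: "cosh (of_int k * (pi * \<i>)) = (-1 :: complex) powi k"
proof -
  have "cosh (of_int k * (pi * \<i>)) = cos (of_real (- (pi * of_int k)))"
    by (simp add: cosh_conv_cos algebra_simps)
  also have "\<dots> = (-1) powi k"
    by (simp only: cos_of_real cos_minus cos_npi_int) (simp add: power_int_minus_left)
  finally show ?thesis .
qed

text \<open>The zeros \<open>x k\<close> of the denominator; \<open>node p k + \<i> / 2 = \<i> k / (2 p)\<close>.\<close>
definition node :: "real \<Rightarrow> int \<Rightarrow> complex" where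
  "node p k = \<i> * (of_int k - of_real p) / (2 * of_real p)"

abbreviation (input) kernel :: "real \<Rightarrow> complex \<Rightarrow> complex" where
  "kernel p x \<equiv> sinh (of_real (pi * p) * (2 * x + \<i>))"

lemma Im_node:
  assumes "p > 0"
  shows "Im (node p k) = of_int k / (2 * p) - 1 / 2"
proof -
  have "node p k = \<i> * of_real ((of_int k - p) / (2 * p))"
    by (simp add: node_def)
  then have "Im (node p k) = (of_int k - p) / (2 * p)"
    by (simp only: Im_i_times Re_complex_of_real)
  then show ?thesis
    using assms by (simp add: field_simps)
qed

lemma inj_node:
  assumes "p > 0"
  shows "inj (node p)"
proof (rule injI)
  fix k l assume "node p k = node p l"
  from arg_cong[OF this, of Im] show "k = l"
    using assms by (simp add: Im_node)
qed

lemma kernel_eq_0_iff: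
  assumes "p > 0"
  shows "kernel p x = 0 \<longleftrightarrow> (\<exists>k. x = node p k)"
proof -
  have "of_real (pi * p) * (2 * x + \<i>) = of_int k * (pi * \<i>) \<longleftrightarrow> x = node p k" for k
  proof -
    have "of_real (pi * p) * (2 * x + \<i>) = of_int k * (pi * \<i>) \<longleftrightarrow>
        of_real pi * (of_real p * (2 * x + \<i>)) = of_real pi * (of_int k * \<i>)"
      by (simp add: mult_ac)
    also have "\<dots> \<longleftrightarrow> of_real p * (2 * x + \<i>) = of_int k * \<i>"
      by (simp only: mult_cancel_left) simp
    also have "\<dots> \<longleftrightarrow> x = node p k"
      using assms unfolding node_def by (simp add: field_simps)
    finally show ?thesis .
  qed
  then show ?thesis
    unfolding sinh_eq_0_iff_complex by simp
qed

lemma DERIV_kernel_node: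
  assumes "p > 0"
  shows "(kernel p has_field_derivative (2 * pi * p) * (-1) powi k) (at (node p k))"
proof -
  have "of_real (pi * p) * (2 * node p k + \<i>) = of_int k * (pi * \<i>)"
    using assms by (simp add: node_def field_simps)
  from arg_cong[OF this, of cosh] show ?thesis
    unfolding cosh_int_pi_i by (auto intro!: derivative_eq_intros)
qed

section \<open>The integral formula\<close>

theorem mainTheorem15:
  fixes p :: real and F :: "complex \<Rightarrow> complex" and U :: "complex set"
  assumes "p > 0"
    and "open U"
    and "\<forall>x\<in>U. - x \<in> U"
    and "{x. \<bar>Im x\<bar> \<le> 1} \<subseteq> U"
    and "F analytic_on U"
    and "\<forall>x\<in>U. F (- x) = - F x"
    and "(\<lambda>x. F x - F (x + \<i>)) \<in> o[strip_ends](\<lambda>x. of_real (exp (pi * norm x) / norm x))"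
    and "((\<lambda>x. (F x - F (x + \<i>)) / sinh (of_real (pi * p) * (2 * x + \<i>))) \<longlongrightarrow> 0) strip_ends"
    and "\<forall>t::real. \<not> is_pole (integrand F p) (of_real t)"
  shows "has_symmetric_integral (\<lambda>t. remove_sings (integrand F p) (of_real t))
     (\<i> / (2 * of_real p) *
       (\<Sum>n = \<lfloor>- p\<rfloor>..-1 + \<lfloor>p\<rfloor>. (-1) powi n *
         (F (\<i> * (of_int n + 1 - of_real p) / (2 * of_real p))
        - F (\<i> * (of_int n + 1 + of_real p) / (2 * of_real p)))))"
proof -
  define G where "G x = F x - F (\<i> + x)" for x
  define f where "f = integrand F p"
  define V where "V = U \<inter> (\<lambda>x. \<i> + x) -` U"
  \<comment> \<open>The bound on the imaginary part excludes all \<open>node p k\<close> with \<open>\<bar>k\<bar> > p\<close>, since such \<open>k\<close>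
      satisfy \<open>\<bar>k\<bar> \<ge> \<lfloor>p\<rfloor> + 1\<close>.\<close>
  define W where "W = V \<inter> {x. \<bar>Im x + 1 / 2\<bar> < (of_int \<lfloor>p\<rfloor> + 1) / (2 * p)}"
  define K where "K = {k::int. \<bar>of_int k\<bar> < p}"
  have f_eq: "f = (\<lambda>x. G x / kernel p x)"
    by (simp add: f_def G_def integrand_def fun_eq_iff)
  have "open V"
    unfolding V_def using \<open>open U\<close>
    by (intro open_Int open_vimage continuous_intros) auto
  then have "open W"
    unfolding W_def by (intro open_Int open_Collect_less continuous_intros) auto
  have stripV: "strip \<subseteq> V"
    unfolding strip_def V_def by (auto intro!: subsetD[OF assms(4)])
  have "p < of_int \<lfloor>p\<rfloor> + 1"
    by linarith
  have stripW: "strip \<subseteq> W"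
  proof
    fix x assume x: "x \<in> strip"
    then have "\<bar>Im x + 1 / 2\<bar> \<le> 1 / 2"
      unfolding strip_def mem_Collect_eq by arith
    also have "\<dots> < (of_int \<lfloor>p\<rfloor> + 1) / (2 * p)"
      using \<open>p > 0\<close> \<open>p < of_int \<lfloor>p\<rfloor> + 1\<close> by (simp add: field_simps)
    finally show "x \<in> W"
      using x stripV by (auto simp: W_def)
  qed
  have "G holomorphic_on V"
  proof -
    have "F holomorphic_on U"
      using assms(5) by (rule analytic_imp_holomorphic)
    then have "F holomorphic_on V" "(F \<circ> (\<lambda>x. \<i> + x)) holomorphic_on V"
      by (auto simp: V_def intro!: holomorphic_on_compose_gen[of _ _ _ U] holomorphic_intros
               intro: holomorphic_on_subset)
    then show ?thesis
      unfolding G_def by (auto intro!: holomorphic_intros simp: o_def)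
  qed
  then have G_an: "G analytic_on {x}" if "x \<in> V" for x
    using that \<open>open V\<close> by (auto simp: analytic_at)
  have kernel_an: "kernel p analytic_on A" for A
    by (intro analytic_intros)
  have f_an: "f analytic_on {x}" if "x \<in> V" "\<And>k. x \<noteq> node p k" for x
    unfolding f_eq using that kernel_eq_0_iff[OF \<open>p > 0\<close>]
    by (intro analytic_intros G_an) auto
  have iso: "isolated_singularity_at f x" if "x \<in> V" for x
    unfolding f_eq using G_an[OF that] kernel_an[of "{x}"]
    by (intro isolated_singularity_at_divide isolated_singularity_at_analytic not_essential_analytic)
  have G_sym: "G (- \<i> - x) = G x" if "x \<in> V" for x
  proof -
    have "F (- \<i> - x) = - F (\<i> + x)" "F (- x) = - F x"
      using that assms(6)[rule_format, of "\<i> + x"] assms(6) by (auto simp: V_def)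
    then show ?thesis
      by (simp add: G_def)
  qed
  have kernel_sym: "kernel p (- \<i> - x) = - kernel p x" for x
    by (simp flip: sinh_minus add: algebra_simps)

  have Im_node_W: "\<bar>of_int k\<bar> \<le> p" if "node p k \<in> W" for k
  proof -
    have "\<bar>of_int k / (2 * p)\<bar> < (of_int \<lfloor>p\<rfloor> + 1) / (2 * p)"
      using that \<open>p > 0\<close> by (simp add: W_def Im_node)
    then have "\<bar>real_of_int k\<bar> < of_int \<lfloor>p\<rfloor> + 1"
      using \<open>p > 0\<close> by (simp add: abs_divide divide_less_cancel)
    then have "\<bar>k\<bar> < \<lfloor>p\<rfloor> + 1"
      by linarith
    then show ?thesis
      by linarith
  qed
  \<comment> \<open>This concerns integer \<open>p\<close> only: the two nodes are \<open>0\<close> and \<open>- \<i>\<close>, on the edges of the strip.\<close>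
  have G_node_boundary: "G (node p k) = 0" if "\<bar>of_int k\<bar> = p" for k
  proof -
    have "G 0 = 0"
    proof (rule ccontr)
      assume "G 0 \<noteq> 0"
      have "complex_of_int \<bar>k\<bar> = of_real p"
        by (metis of_int_abs of_real_of_int_eq that)
      then have "node p \<bar>k\<bar> = 0"
        by (simp add: node_def)
      then have D: "(kernel p has_field_derivative (2 * pi * p) * (-1) powi \<bar>k\<bar>) (at 0)"
        using DERIV_kernel_node[OF \<open>p > 0\<close>] by metis
      have "kernel p 0 = 0"
        using \<open>node p \<bar>k\<bar> = 0\<close> kernel_eq_0_iff[OF \<open>p > 0\<close>] by metis
      moreover have "isCont G 0"
        using stripV by (intro analytic_at_imp_isCont G_an) (auto simp: strip_def)
      ultimately have "is_pole f 0"
        unfolding f_eq using \<open>G 0 \<noteq> 0\<close> \<open>p > 0\<close>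
        by (intro is_pole_divide_DERIV_nonzero[OF _ _ D]) auto
      then show False
        using assms(9)[rule_format, of 0] by (simp add: f_def)
    qed
    moreover have "G (- \<i>) = G 0"
      using G_sym[of 0] stripV by (force simp: strip_def)
    moreover have "node p k = 0 \<or> node p k = - \<i>"
    proof -
      have "of_int k = p \<or> of_int k = - p"
        using that by linarith
      then have "of_int k = complex_of_real p \<or> of_int k = complex_of_real (- p)"
        by (metis of_real_of_int_eq)
      then show ?thesis
        using \<open>p > 0\<close> by (auto simp: node_def)
    qed
    ultimately show ?thesis
      by auto
  qed

  define g where "g = remove_sings f"
  have g_an: "g analytic_on {x}" if "x \<in> W - node p ` K" for x
  proof (cases "\<exists>k. x = node p k")
    case False
    then show ?thesis
      using that f_an unfolding g_def by (intro remove_sings_analytic_on) (auto simp: W_def)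
  next
    case True
    then obtain k where k: "x = node p k" by blast
    \<comment> \<open>A node on the edge of the strip: numerator and denominator vanish, so \<open>f\<close> has a finite
        limit by l'Hopital's rule.\<close>
    then have "\<bar>of_int k\<bar> = p"
      using that Im_node_W[of k] by (force simp: K_def)
    then have "G x = 0"
      using G_node_boundary k by simp
    have "x \<in> V" using that by (simp add: W_def)
    then obtain G' where "(G has_field_derivative G') (at x)"
      using G_an by (metis analytic_at_imp_isCont analytic_on_imp_differentiable_at field_differentiable_def singletonI)
    from lhopital_complex_simple[OF this DERIV_kernel_node[OF \<open>p > 0\<close>, of k, folded k]
        \<open>G x = 0\<close> _ _ refl]
    have "f \<midarrow>x\<rightarrow> G' / ((2 * pi * p) * (-1) powi k)"
      using \<open>p > 0\<close> k kernel_eq_0_iff[OF \<open>p > 0\<close>] by (auto simp: f_eq)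
    then show ?thesis
      unfolding g_def by (rule remove_sings_analytic_at[OF iso[OF \<open>x \<in> V\<close>]])
  qed
  have node_real: "Re (node p k) = 0" for k
    using Re_i_times[of "of_real ((of_int k - p) / (2 * p))"] by (simp add: node_def)
  have g_eq: "g x = f x" if "x \<in> strip" "Re x \<noteq> 0" for x
    unfolding g_def
    using that node_real
    by (intro remove_sings_at_analytic f_an subsetD[OF stripV]) auto
  have node_strip: "-1 < Im (node p k) \<and> Im (node p k) < 0" if "k \<in> K" for k
    using that \<open>p > 0\<close> by (auto simp: Im_node K_def field_simps abs_less_iff)
  have "K \<subseteq> {\<lfloor>- p\<rfloor>..\<lceil>p\<rceil>}"
    by (auto simp: K_def) linarith+
  then have "finite K"
    by (rule finite_subset) auto

  have "has_symmetric_integral (\<lambda>t. g (of_real t)) (- (pi * \<i> * (\<Sum>z\<in>node p ` K. residue g z)))"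
  proof (rule has_symmetric_integral_odd_about_strip_centre[OF \<open>open W\<close> stripW])
    show "finite (node p ` K)"
      using \<open>finite K\<close> by simp
    show "-1 < Im z \<and> Im z < 0" if "z \<in> node p ` K" for z
      using that node_strip by blast
    show "g holomorphic_on W - node p ` K"
      using g_an analytic_on_analytic_at analytic_imp_holomorphic by blast
    show "g (- \<i> - of_real t) = - g (of_real t)" if "t \<noteq> 0" for t :: real
    proof -
      have "(of_real t :: complex) \<in> strip" "- \<i> - of_real t \<in> strip"
        by (auto simp: strip_def)
      then show ?thesis
        using that stripV G_sym[of "of_real t"] kernel_sym[of "of_real t"]
        by (simp add: g_eq f_eq subset_iff)
    qed
    show "(g \<longlongrightarrow> 0) strip_ends"
    proof (rule Lim_transform_eventually)
      show "(f \<longlongrightarrow> 0) strip_ends"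
        using assms(8) by (simp add: f_eq G_def add.commute)
      have "\<forall>x\<in>strip. 1 \<le> \<bar>Re x\<bar> \<longrightarrow> f x = g x"
        using g_eq by force
      then show "eventually (\<lambda>x. f x = g x) strip_ends"
        unfolding eventually_strip_ends by blast
    qed
  qed
  moreover have "(\<Sum>z\<in>node p ` K. residue g z)
      = (\<Sum>k\<in>K. (-1) powi k * G (node p k)) / (2 * pi * p)"
  proof -
    have "residue g (node p k) = (-1) powi k * G (node p k) / (2 * pi * p)" if "k \<in> K" for k
    proof -
      have V: "node p k \<in> V"
        using node_strip[OF that] by (intro subsetD[OF stripV]) (auto simp: strip_def)
      have "residue g (node p k) = residue f (node p k)"
        unfolding g_def by (rule residue_remove_sings[OF iso[OF V]])
      also have "\<dots> = G (node p k) / ((2 * pi * p) * (-1) powi k)"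
        unfolding f_eq
        by (rule residue_divide_DERIV_nonzero[OF _ DERIV_kernel_node])
           (use \<open>p > 0\<close> V G_an iso[OF V] kernel_eq_0_iff[OF \<open>p > 0\<close>] in
             \<open>auto simp: f_eq analytic_at_imp_isCont\<close>)
      also have "\<dots> = (-1) powi k * G (node p k) / (2 * pi * p)"
        by (simp add: power_int_minus_left)
      finally show ?thesis .
    qed
    then show ?thesis
      by (simp add: sum.reindex[OF inj_on_subset[OF inj_node[OF \<open>p > 0\<close>]]] sum_divide_distrib)
  qed
  \<comment> \<open>For integer \<open>p\<close> the interval contains one index outside \<open>K\<close>, namely \<open>k = p\<close>.\<close>
  moreover have "(\<Sum>k\<in>K. (-1) powi k * G (node p k))
      = (\<Sum>k = \<lfloor>- p\<rfloor> + 1..\<lfloor>p\<rfloor>. (-1) powi k * G (node p k))"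
  proof (rule sum.mono_neutral_left)
    show "K \<subseteq> {\<lfloor>- p\<rfloor> + 1..\<lfloor>p\<rfloor>}"
      unfolding K_def by (auto simp: le_floor_iff floor_less_iff abs_less_iff add1_zle_eq)
    show "\<forall>k\<in>{\<lfloor>- p\<rfloor> + 1..\<lfloor>p\<rfloor>} - K. (-1) powi k * G (node p k) = 0"
    proof
      fix k assume k: "k \<in> {\<lfloor>- p\<rfloor> + 1..\<lfloor>p\<rfloor>} - K"
      then have "of_int k \<le> p" "- p < of_int k" "\<not> \<bar>of_int k\<bar> < p"
        by (auto simp: le_floor_iff floor_less_iff K_def add1_zle_eq)
      then have "\<bar>of_int k\<bar> = p"
        by linarith
      then show "(-1) powi k * G (node p k) = 0"
        using G_node_boundary by simp
    qed
  qed simp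
  moreover have "(\<Sum>k = \<lfloor>- p\<rfloor> + 1..\<lfloor>p\<rfloor>. (-1) powi k * G (node p k))
      = - (\<Sum>n = \<lfloor>- p\<rfloor>..-1 + \<lfloor>p\<rfloor>. (-1) powi n *
         (F (\<i> * (of_int n + 1 - of_real p) / (2 * of_real p))
        - F (\<i> * (of_int n + 1 + of_real p) / (2 * of_real p))))"
  proof -
    have shift: "\<i> + \<i> * (of_int n + 1 - of_real p) / (2 * of_real p)
        = \<i> * (of_int n + 1 + of_real p) / (2 * of_real p)" for n
      using \<open>p > 0\<close> by (simp add: field_simps)
    have "(\<Sum>k = \<lfloor>- p\<rfloor> + 1..\<lfloor>p\<rfloor>. (-1) powi k * G (node p k))
        = (\<Sum>n = \<lfloor>- p\<rfloor>..-1 + \<lfloor>p\<rfloor>. (-1) powi (n + 1) * G (node p (n + 1)))"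
      by (rule sum.reindex_bij_witness[of _ "\<lambda>n. n + 1" "\<lambda>k. k - 1"]) auto
    also have "\<dots> = (\<Sum>n = \<lfloor>- p\<rfloor>..-1 + \<lfloor>p\<rfloor>. - ((-1) powi n *
         (F (\<i> * (of_int n + 1 - of_real p) / (2 * of_real p))
        - F (\<i> * (of_int n + 1 + of_real p) / (2 * of_real p)))))"
      by (intro sum.cong refl)
         (simp add: G_def node_def shift[simplified] power_int_add_1)
    finally show ?thesis
      by (simp add: sum_negf)
  qed
  ultimately show ?thesis
    using \<open>p > 0\<close> by (simp add: g_def f_def)
qed

end
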